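(* For every $\theta\in(0,\pi]$ there is a $T$-equivariant homeomorphism $\Phi_\theta: X_\theta\to \mathbb{P}^3(\mathbb{R})$.
   Context: $T\subset SU(2)$ is the maximal torus of diagonal matrices. Elements of $SU(2)$ are written as unit quaternions $z+wj$ with $z,w\in\mathbb{C}$, $|z|^2+|w|^2=1$, so that $T=\{e^{i\alpha}\}$. $[g,h]=ghg^{-1}h^{-1}$. For $\theta\in[0,\pi]$, $X_\theta:=\{(g,h)\in SU(2)\times SU(2)\mid [g,h]=e^{i\theta}\}$. $T$ acts on $X_\theta$ by diagonal conjugation, and on $\mathbb{P}^3(\mathbb{R})\cong PSU(2)=SU(2)/\{\pm I\}$ by left multiplication. *)

theory Defs
  imports "HOL-Analysis.Analysis"
begin

section \<open>The group SU(2)\<close>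

definition adjoint_mat :: "complex^'n^'m \<Rightarrow> complex^'m^'n" where
  "adjoint_mat A = transpose (map_matrix cnj A)"

definition SU2 :: "(complex^2^2) set" where
  "SU2 = {A. A ** adjoint_mat A = mat 1 \<and> det A = 1}"

text \<open>The matrix of the quaternion \<open>z + w j\<close>, where \<open>j z = cnj z j\<close>; in particular
  \<open>quat (cis \<alpha>) 0\<close> is the element written \<open>exp (i \<alpha>)\<close> of the maximal torus.\<close>

definition quat :: "complex \<Rightarrow> complex \<Rightarrow> complex^2^2" where
  "quat z w = vector [vector [z, w], vector [- cnj w, cnj z]]"

definition torus :: "(complex^2^2) set" where
  "torus = {A \<in> SU2. A $ 1 $ 2 = 0 \<and> A $ 2 $ 1 = 0}"

definition commutator :: "complex^2^2 \<Rightarrow> complex^2^2 \<Rightarrow> complex^2^2" where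
  "commutator g h = g ** h ** matrix_inv g ** matrix_inv h"

definition conj_by :: "complex^2^2 \<Rightarrow> complex^2^2 \<Rightarrow> complex^2^2" where
  "conj_by t g = t ** g ** matrix_inv t"

definition X_set :: "real \<Rightarrow> ((complex^2^2) \<times> (complex^2^2)) set" where
  "X_set \<theta> = {(g, h). g \<in> SU2 \<and> h \<in> SU2 \<and> commutator g h = quat (cis \<theta>) 0}"

definition diag_conj ::
  "complex^2^2 \<Rightarrow> (complex^2^2) \<times> (complex^2^2) \<Rightarrow> (complex^2^2) \<times> (complex^2^2)" where
  "diag_conj t p = (conj_by t (fst p), conj_by t (snd p))"


section \<open>Real projective space as PSU(2)\<close>

definition quotient_topology :: "'a topology \<Rightarrow> ('a \<Rightarrow> 'b) \<Rightarrow> 'b topology" where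
  "quotient_topology T f =
     topology (\<lambda>U. U \<subseteq> f ` topspace T \<and> openin T {x \<in> topspace T. f x \<in> U})"

definition psu_class :: "complex^2^2 \<Rightarrow> (complex^2^2) set" where
  "psu_class A = {A, - A}"

definition PSU2 :: "(complex^2^2) set topology" where
  "PSU2 = quotient_topology (top_of_set SU2) psu_class"

definition left_mult :: "complex^2^2 \<Rightarrow> (complex^2^2) set \<Rightarrow> (complex^2^2) set" where
  "left_mult t P = (\<lambda>A. t ** A) ` P"

text \<open>The space of real lines through the origin in real 4-space.  The lemma
  \<open>PSU2_homeomorphic_RP3\<close> below justifies using \<^const>\<open>PSU2\<close>, which carries the
  action by left multiplication, as the model of this space.\<close>

definition RP3 :: "(real^4) set topology" where
  "RP3 = quotient_topology (top_of_set (UNIV - {0})) (\<lambda>v. span {v})"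


section \<open>Basic facts\<close>

lemma istopology_quotient:
  "istopology (\<lambda>U. U \<subseteq> f ` topspace T \<and> openin T {x \<in> topspace T. f x \<in> U})"
proof -
  have 1: "{x \<in> topspace T. f x \<in> U \<inter> V} = {x \<in> topspace T. f x \<in> U} \<inter> {x \<in> topspace T. f x \<in> V}"
    for U V by blast
  have 2: "{x \<in> topspace T. f x \<in> \<Union>K} = \<Union>((\<lambda>U. {x \<in> topspace T. f x \<in> U}) ` K)" for K
    by blast
  show ?thesis
    unfolding istopology_def
  proof (intro conjI allI impI)
    fix U V
    assume "U \<subseteq> f ` topspace T \<and> openin T {x \<in> topspace T. f x \<in> U}"
      and "V \<subseteq> f ` topspace T \<and> openin T {x \<in> topspace T. f x \<in> V}"
    then show "U \<inter> V \<subseteq> f ` topspace T" "openin T {x \<in> topspace T. f x \<in> U \<inter> V}"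
      unfolding 1 by auto
  next
    fix K
    assume K: "\<forall>U\<in>K. U \<subseteq> f ` topspace T \<and> openin T {x \<in> topspace T. f x \<in> U}"
    then show "\<Union>K \<subseteq> f ` topspace T"
      by (intro Union_least) simp
    show "openin T {x \<in> topspace T. f x \<in> \<Union>K}"
      unfolding 2 using K by (intro openin_Union) auto
  qed
qed

lemma openin_quotient_topology:
  "openin (quotient_topology T f) U \<longleftrightarrow>
     U \<subseteq> f ` topspace T \<and> openin T {x \<in> topspace T. f x \<in> U}"
  unfolding quotient_topology_def topology_inverse'[OF istopology_quotient] ..

lemma topspace_quotient_topology: "topspace (quotient_topology T f) = f ` topspace T"
proof -
  have "{x \<in> topspace T. f x \<in> f ` topspace T} = topspace T"
    by blast
  then have "openin (quotient_topology T f) (f ` topspace T)"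
    by (simp add: openin_quotient_topology)
  then have "f ` topspace T \<subseteq> topspace (quotient_topology T f)"
    by (rule openin_subset)
  moreover have "topspace (quotient_topology T f) \<subseteq> f ` topspace T"
    using openin_topspace[of "quotient_topology T f"] by (simp only: openin_quotient_topology)
  ultimately show ?thesis
    by (rule subset_antisym[rotated])
qed

lemma quotient_map_quotient_topology: "quotient_map T (quotient_topology T f) f"
  by (simp add: quotient_map_def topspace_quotient_topology openin_quotient_topology)

lemma quot_map_PSU2: "quotient_map (top_of_set SU2) PSU2 psu_class"
  unfolding PSU2_def by (rule quotient_map_quotient_topology)

lemma mat2_eq_iff:
  "A = B \<longleftrightarrow> A$1$1 = B$1$1 \<and> A$1$2 = B$1$2 \<and> A$2$1 = B$2$1 \<and> A$2$2 = (B :: complex^2^2)$2$2"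
  by (auto simp: vec_eq_iff forall_2)

lemma quat_nth [simp]:
  "quat z w $ 1 $ 1 = z" "quat z w $ 1 $ 2 = w"
  "quat z w $ 2 $ 1 = - cnj w" "quat z w $ 2 $ 2 = cnj z"
  by (simp_all add: quat_def)

lemma mult_nth: "((A :: complex^2^2) ** B) $ i $ j = A$i$1 * B$1$j + A$i$2 * B$2$j"
  by (simp add: matrix_matrix_mult_def sum_2)

lemma mat1_nth: "(mat 1 :: complex^2^2) $ i $ j = (if i = j then 1 else 0)"
  by (simp add: mat_def)

lemma adjoint_mat_nth: "adjoint_mat A $ i $ j = cnj (A $ j $ i)"
  by (simp add: adjoint_mat_def transpose_def map_matrix_def)

lemma quat_mult: "quat z w ** quat z' w' = quat (z * z' - w * cnj w') (z * w' + w * cnj z')"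
  by (simp add: mat2_eq_iff mult_nth)

lemma quat_one: "quat 1 0 = mat 1"
  by (simp add: mat2_eq_iff mat1_nth)

lemma adjoint_quat: "adjoint_mat (quat z w) = quat (cnj z) (- w)"
  by (simp add: mat2_eq_iff adjoint_mat_nth)

lemma cmod_sum_iff:
  "z * cnj z + w * cnj w = 1 \<longleftrightarrow> (cmod z)\<^sup>2 + (cmod w)\<^sup>2 = 1"
proof -
  have "z * cnj z + w * cnj w = of_real ((cmod z)\<^sup>2 + (cmod w)\<^sup>2)"
    by (simp only: complex_norm_square of_real_add)
  then show ?thesis
    by (simp only: of_real_eq_1_iff)
qed

lemma quat_mem_SU2: "quat z w \<in> SU2 \<longleftrightarrow> (cmod z)\<^sup>2 + (cmod w)\<^sup>2 = 1"
  unfolding cmod_sum_iff [symmetric]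
  by (simp add: SU2_def adjoint_quat quat_mult mat2_eq_iff mat1_nth det_2 mult.commute)

lemma adjoint_inverse:
  assumes "A \<in> SU2"
  shows "A ** adjoint_mat A = mat 1" "adjoint_mat A ** A = mat 1"
proof -
  show "A ** adjoint_mat A = mat 1"
    using assms by (simp add: SU2_def)
  then show "adjoint_mat A ** A = mat 1"
    by (rule matrix_left_right_inverse[THEN iffD1])
qed

lemma mat_inv_eqI:
  fixes A :: "complex^2^2"
  assumes "A ** B = mat 1"
  shows "matrix_inv A = B"
proof -
  have BA: "B ** A = mat 1"
    using assms by (rule matrix_left_right_inverse[THEN iffD1])
  have "A ** matrix_inv A = mat 1 \<and> matrix_inv A ** A = mat 1"
    unfolding matrix_inv_def
    by (intro someI[of "\<lambda>C. A ** C = mat 1 \<and> C ** A = mat 1" B] conjI assms BA)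
  then have "matrix_inv A ** (A ** B) = B"
    by (simp add: matrix_mul_assoc)
  then show ?thesis
    by (simp add: assms)
qed

lemma matrix_inv_SU2:
  assumes "A \<in> SU2"
  shows "matrix_inv A = adjoint_mat A"
  by (rule mat_inv_eqI) (rule adjoint_inverse(1)[OF assms])

lemma SU2_eq_unit_quaternions: "SU2 = {quat z w | z w. (cmod z)\<^sup>2 + (cmod w)\<^sup>2 = 1}"
proof -
  have "\<exists>z w. A = quat z w" if A: "A \<in> SU2" for A
  proof -
    let ?B = "\<chi> i j. if i = 1 then (if j = 1 then A$2$2 else - A$1$2)
                     else (if j = 1 then - A$2$1 else A$1$1)"
    have d: "A$1$1 * A$2$2 - A$1$2 * A$2$1 = 1"
      using A by (simp add: SU2_def det_2)
    have "?B ** A = mat 1"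
      using d by (simp add: mat2_eq_iff mult_nth mat1_nth algebra_simps)
    then have "?B ** A ** adjoint_mat A = adjoint_mat A"
      by simp
    then have B: "?B = adjoint_mat A"
      by (simp add: matrix_mul_assoc [symmetric] adjoint_inverse(1)[OF A])
    have "A$2$2 = cnj (A$1$1)"
      using arg_cong[OF B, of "\<lambda>M. M$1$1"] by (simp add: adjoint_mat_nth)
    moreover have "- A$2$1 = cnj (A$1$2)"
      using arg_cong[OF B, of "\<lambda>M. M$2$1"] by (simp add: adjoint_mat_nth)
    then have "A$2$1 = - cnj (A$1$2)"
      by (metis minus_minus)
    ultimately have "A = quat (A$1$1) (A$1$2)"
      by (simp add: mat2_eq_iff)
    then show ?thesis by blast
  qed
  then show ?thesis
    using quat_mem_SU2 by blast
qed

lemma torus_eq: "torus = {quat (cis \<alpha>) 0 | \<alpha>. True}"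
proof -
  have "\<exists>\<alpha>. z = cis \<alpha>" if "(cmod z)\<^sup>2 = 1" for z
  proof -
    from that have "cmod z = 1"
      by (simp add: power2_eq_1_iff) (use norm_ge_zero[of z] in linarith)
    then show ?thesis
      by (metis complex_norm_eq_1_exp cis_conv_exp)
  qed
  then show ?thesis
    by (auto simp: torus_def quat_mem_SU2) (fastforce simp: SU2_eq_unit_quaternions)
qed

lemma SU2_mult:
  assumes "A \<in> SU2" "B \<in> SU2"
  shows "A ** B \<in> SU2"
proof -
  have "adjoint_mat (A ** B) = adjoint_mat B ** adjoint_mat A"
    by (simp add: mat2_eq_iff mult_nth adjoint_mat_nth algebra_simps)
  then have "(A ** B) ** adjoint_mat (A ** B) = A ** (B ** adjoint_mat B) ** adjoint_mat A"
    by (simp add: matrix_mul_assoc)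
  then show ?thesis
    using assms by (simp add: SU2_def det_mul)
qed

lemma SU2_adjoint:
  assumes "A \<in> SU2"
  shows "adjoint_mat A \<in> SU2"
proof -
  obtain z w where "A = quat z w" "(cmod z)\<^sup>2 + (cmod w)\<^sup>2 = 1"
    using assms by (auto simp: SU2_eq_unit_quaternions)
  then show ?thesis
    by (simp add: adjoint_quat quat_mem_SU2)
qed

lemma torus_subset_SU2: "torus \<subseteq> SU2"
  by (auto simp: torus_def)

lemma conj_by_mult:
  assumes "t \<in> SU2"
  shows "conj_by t g ** conj_by t h = conj_by t (g ** h)"
  unfolding conj_by_def matrix_inv_SU2[OF assms]
proof -
  have "t ** g ** adjoint_mat t ** (t ** h ** adjoint_mat t) =
        t ** g ** (adjoint_mat t ** t) ** h ** adjoint_mat t"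
    by (simp only: matrix_mul_assoc)
  then show "t ** g ** adjoint_mat t ** (t ** h ** adjoint_mat t) = t ** (g ** h) ** adjoint_mat t"
    by (simp add: adjoint_inverse(2)[OF assms] matrix_mul_assoc)
qed

lemma conj_by_SU2: "t \<in> SU2 \<Longrightarrow> g \<in> SU2 \<Longrightarrow> conj_by t g \<in> SU2"
  by (simp add: conj_by_def matrix_inv_SU2 SU2_adjoint SU2_mult)

lemma conj_by_inv:
  assumes t: "t \<in> SU2" and g: "g \<in> SU2"
  shows "matrix_inv (conj_by t g) = conj_by t (matrix_inv g)"
proof -
  have "conj_by t (mat 1) = mat 1"
    by (simp add: conj_by_def matrix_inv_SU2[OF t] adjoint_inverse[OF t])
  then have "conj_by t g ** conj_by t (adjoint_mat g) = mat 1"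
    by (simp add: conj_by_mult[OF t] adjoint_inverse[OF g])
  then show ?thesis
    unfolding matrix_inv_SU2[OF g] by (intro mat_inv_eqI)
qed

lemma diag_conj_X:
  assumes t: "t \<in> torus" and p: "p \<in> X_set \<theta>"
  shows "diag_conj t p \<in> X_set \<theta>"
proof -
  have tS: "t \<in> SU2" using t torus_subset_SU2 by blast
  obtain g h where [simp]: "p = (g, h)" by (cases p)
  have gh: "g \<in> SU2" "h \<in> SU2" "commutator g h = quat (cis \<theta>) 0"
    using p by (auto simp: X_set_def)
  obtain \<alpha> where \<alpha>: "t = quat (cis \<alpha>) 0"
    using t by (auto simp: torus_eq)
  have "commutator (conj_by t g) (conj_by t h) = conj_by t (commutator g h)"
    using gh by (simp add: commutator_def conj_by_inv tS conj_by_mult)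
  also have "\<dots> = quat (cis \<theta>) 0"
    unfolding gh conj_by_def matrix_inv_SU2[OF tS]
    by (simp add: \<alpha> adjoint_quat quat_mult cis_cnj cis_mult)
  finally show ?thesis
    using gh tS by (simp add: diag_conj_def X_set_def conj_by_SU2)
qed

lemma left_mult_psu_class: "left_mult t (psu_class A) = psu_class (t ** A)"
proof -
  have "t ** (- A) = - (t ** A)"
    by (simp add: mat2_eq_iff mult_nth)
  then show ?thesis
    by (simp add: left_mult_def psu_class_def)
qed

lemma psu_class_eq_iff: "psu_class A = psu_class B \<longleftrightarrow> A = B \<or> A = - B"
  by (auto simp: psu_class_def doubleton_eq_iff)

lemma left_mult_PSU2:
  assumes "t \<in> torus" "P \<in> topspace PSU2"
  shows "left_mult t P \<in> topspace PSU2"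
  using assms torus_subset_SU2
  by (force simp: PSU2_def topspace_quotient_topology left_mult_psu_class intro: SU2_mult)


lemma homeomorphic_space_quotients:
  assumes f: "quotient_map T Y f" and g: "quotient_map T Z g"
    and fg: "\<And>x y. x \<in> topspace T \<Longrightarrow> y \<in> topspace T \<Longrightarrow> f x = f y \<longleftrightarrow> g x = g y"
  shows "Y homeomorphic_space Z"
proof -
  obtain h where h: "continuous_map Y Z h" "\<And>x. x \<in> topspace T \<Longrightarrow> h (f x) = g x"
    using quotient_map_lift_exists[OF f quotient_imp_continuous_map[OF g]] fg by metis
  obtain k where k: "continuous_map Z Y k" "\<And>x. x \<in> topspace T \<Longrightarrow> k (g x) = f x"
    using quotient_map_lift_exists[OF g quotient_imp_continuous_map[OF f]] fg by metis
  have "topspace Y = f ` topspace T" "topspace Z = g ` topspace T"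
    using f g by (auto simp: quotient_map_def)
  then have "homeomorphic_maps Y Z h k"
    using h k by (auto simp: homeomorphic_maps_def)
  then show ?thesis
    by (auto simp: homeomorphic_space_def)
qed

definition vec_quat :: "real^4 \<Rightarrow> complex^2^2" where
  "vec_quat v = quat (Complex (v$1) (v$2)) (Complex (v$3) (v$4))"

definition quat_vec :: "complex^2^2 \<Rightarrow> real^4" where
  "quat_vec A = (\<chi> i. if i = 1 then Re (A$1$1) else if i = 2 then Im (A$1$1)
                      else if i = 3 then Re (A$1$2) else Im (A$1$2))"

lemma vec_quat_mem_SU2: "vec_quat v \<in> SU2 \<longleftrightarrow> norm v = 1"
proof -
  have "(norm v)\<^sup>2 = (v$1)\<^sup>2 + (v$2)\<^sup>2 + ((v$3)\<^sup>2 + (v$4)\<^sup>2)"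
    by (simp add: norm_vec_def L2_set_def sum_4 add_nonneg_nonneg)
  then have "vec_quat v \<in> SU2 \<longleftrightarrow> (norm v)\<^sup>2 = 1"
    by (simp add: vec_quat_def quat_mem_SU2 cmod_power2)
  also have "\<dots> \<longleftrightarrow> norm v = 1"
    unfolding power2_eq_1_iff using norm_ge_zero[of v] by (smt (verit))
  finally show ?thesis .
qed

lemma vec_quat_inverse: "quat_vec (vec_quat v) = v"
  by (simp add: vec_quat_def quat_vec_def vec_eq_iff forall_4)

lemma quat_vec_inverse:
  assumes "A \<in> SU2"
  shows "vec_quat (quat_vec A) = A"
  using assms
  by (auto simp: SU2_eq_unit_quaternions vec_quat_def quat_vec_def mat2_eq_iff complex_eq_iff)

lemma vec_quat_minus: "vec_quat (- v) = - vec_quat v"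
  by (simp add: vec_quat_def mat2_eq_iff complex_eq_iff)

lemma linear_vec_quat: "linear vec_quat"
  by (rule linearI) (simp_all add: vec_quat_def mat2_eq_iff complex_eq_iff)

lemma linear_quat_vec: "linear quat_vec"
  by (rule linearI) (simp_all add: quat_vec_def vec_eq_iff)

lemma span_singleton_eq_iff:
  fixes x y :: "real^4"
  assumes x: "x \<noteq> 0" and y: "y \<noteq> 0"
  shows "span {x} = span {y} \<longleftrightarrow> x /\<^sub>R norm x = y /\<^sub>R norm y \<or> x /\<^sub>R norm x = - (y /\<^sub>R norm y)"
proof
  assume "span {x} = span {y}"
  then have "x \<in> span {y}"
    using span_base[of x "{x}"] by simp
  then obtain k where k: "x = k *\<^sub>R y"
    by (auto simp: span_singleton)
  then have "k \<noteq> 0"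
    using x by auto
  then show "x /\<^sub>R norm x = y /\<^sub>R norm y \<or> x /\<^sub>R norm x = - (y /\<^sub>R norm y)"
    by (cases "k > 0") (simp_all add: k)
next
  have *: "span {u} \<subseteq> span {v}"
    if "v \<noteq> 0" "u \<noteq> 0" "u /\<^sub>R norm u = v /\<^sub>R norm v \<or> u /\<^sub>R norm u = - (v /\<^sub>R norm v)" for u v :: "real^4"
  proof -
    have "u = norm u *\<^sub>R (u /\<^sub>R norm u)"
      using that by simp
    also have "u /\<^sub>R norm u \<in> span {v}"
      using that(3) by (elim disjE) (simp_all only: span_mul span_neg span_base singletonI)
    then have "norm u *\<^sub>R (u /\<^sub>R norm u) \<in> span {v}"
      by (rule span_mul)
    finally show ?thesis
      by (simp add: span_minimal)
  qed
  assume a: "x /\<^sub>R norm x = y /\<^sub>R norm y \<or> x /\<^sub>R norm x = - (y /\<^sub>R norm y)"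
  then have "y /\<^sub>R norm y = x /\<^sub>R norm x \<or> y /\<^sub>R norm y = - (x /\<^sub>R norm x)"
    by (elim disjE) (simp_all only: minus_minus simp_thms)
  then show "span {x} = span {y}"
    using *[OF y x a] *[OF x y] by (intro subset_antisym) simp_all
qed

theorem PSU2_homeomorphic_RP3: "PSU2 homeomorphic_space RP3"
proof -
  let ?D = "UNIV - {0 :: real^4}"
  define n where "n = (\<lambda>v :: real^4. vec_quat (v /\<^sub>R norm v))"
  have cont: "continuous_on ?D n"
  proof -
    have "continuous_on ?D (\<lambda>v. v /\<^sub>R norm v)"
      by (intro continuous_intros) auto
    moreover have "continuous_on UNIV vec_quat"
      using linear_vec_quat linear_continuous_on linear_conv_bounded_linear by blast
    ultimately show ?thesis
      unfolding n_def using continuous_on_compose2[of UNIV vec_quat] by blast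
  qed
  have mem: "n v \<in> SU2" if "v \<noteq> 0" for v
    using that by (simp add: n_def vec_quat_mem_SU2)
  have cont': "continuous_on SU2 quat_vec"
    using linear_quat_vec linear_continuous_on linear_conv_bounded_linear by blast
  have norm_qv: "norm (quat_vec A) = 1" if "A \<in> SU2" for A
    using that quat_vec_inverse vec_quat_mem_SU2 by metis
  have "retraction_maps (top_of_set ?D) (top_of_set SU2) n quat_vec"
    unfolding retraction_maps_def
  proof (intro conjI ballI)
    show "continuous_map (top_of_set ?D) (top_of_set SU2) n"
      using cont mem by auto
    show "continuous_map (top_of_set SU2) (top_of_set ?D) quat_vec"
      using cont' norm_qv by force
    show "n (quat_vec A) = A" if "A \<in> topspace (top_of_set SU2)" for A
      using that by (simp add: n_def norm_qv quat_vec_inverse)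
  qed
  then have "quotient_map (top_of_set ?D) (top_of_set SU2) n"
    by (intro retraction_imp_quotient_map) (auto simp: retraction_map_def)
  then have q: "quotient_map (top_of_set ?D) PSU2 (psu_class \<circ> n)"
    by (rule quotient_map_compose) (rule quot_map_PSU2)
  have r: "quotient_map (top_of_set ?D) RP3 (\<lambda>v. span {v})"
    unfolding RP3_def by (rule quotient_map_quotient_topology)
  show ?thesis
  proof (rule homeomorphic_space_quotients[OF q r])
    fix x y :: "real^4"
    assume "x \<in> topspace (top_of_set ?D)" "y \<in> topspace (top_of_set ?D)"
    then have nz: "x \<noteq> 0" "y \<noteq> 0"
      by auto
    have inj: "vec_quat u = vec_quat v \<longleftrightarrow> u = v" for u v
      using vec_quat_inverse by metis
    have "(psu_class \<circ> n) x = (psu_class \<circ> n) y \<longleftrightarrow>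
        vec_quat (x /\<^sub>R norm x) = vec_quat (y /\<^sub>R norm y) \<or>
        vec_quat (x /\<^sub>R norm x) = vec_quat (- (y /\<^sub>R norm y))"
      by (simp only: o_apply n_def psu_class_eq_iff vec_quat_minus)
    then show "(psu_class \<circ> n) x = (psu_class \<circ> n) y \<longleftrightarrow> span {x} = span {y}"
      by (simp only: inj span_singleton_eq_iff[OF nz])
  qed
qed

end

theory Submission
  imports Defs
begin

text \<open>Taking traces, \<open>[g, h] = exp (i \<theta>)\<close> forces \<open>g = e (r + u j)\<close> and \<open>h = cnj e s + w j\<close> with
  \<open>e = exp (i \<theta>/2)\<close> and \<open>r\<close>, \<open>s\<close> real, and the equation that remains is
  \<open>sin (\<theta>/2) r s + Im (u cnj w) = 0\<close>.  So \<open>X_set \<theta>\<close> consists of pairs of unit vectors \<open>(r, - i u)\<close>,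
  \<open>(s, w)\<close> in \<open>\<real> \<times> \<complex>\<close> which are orthogonal for the bilinear form \<open>diag (sin (\<theta>/2), 1, 1)\<close>.  This
  form is positive definite; applying it to the first vector and normalising gives an orthonormal
  pair, that is, a rotation.  All these maps commute with rotations of the \<open>\<complex>\<close>-factor, hence with
  the torus.\<close>

section \<open>Solving the commutator equation in coordinates\<close>

lemma commutator_eq_iff:
  assumes g: "g \<in> SU2" and h: "h \<in> SU2"
  shows "commutator g h = D \<longleftrightarrow> g ** h = D ** (h ** g)"
proof
  assume "commutator g h = D"
  then have "D ** (h ** g) = g ** h ** adjoint_mat g ** (adjoint_mat h ** h) ** g"
    by (auto simp: commutator_def matrix_inv_SU2 g h matrix_mul_assoc)
  also have "\<dots> = g ** h ** (adjoint_mat g ** g)"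
    by (simp add: adjoint_inverse(2)[OF h] matrix_mul_assoc)
  finally show "g ** h = D ** (h ** g)"
    by (simp add: adjoint_inverse(2)[OF g])
next
  assume "g ** h = D ** (h ** g)"
  then have "commutator g h = D ** h ** (g ** adjoint_mat g) ** adjoint_mat h"
    by (simp add: commutator_def matrix_inv_SU2 g h matrix_mul_assoc)
  also have "\<dots> = D ** (h ** adjoint_mat h)"
    by (simp add: adjoint_inverse(1)[OF g] matrix_mul_assoc)
  finally show "commutator g h = D"
    by (simp add: adjoint_inverse(1)[OF h])
qed

lemma trace_quat: "trace (quat z w) = of_real (2 * Re z)"
  by (simp add: trace_def sum_2 complex_eq_iff)

text \<open>The hypothesis makes \<open>k\<close> the conjugate of \<open>h\<close> by
  \<open>g\<close>. For the commutator equation it is applied once in each variable.\<close>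

lemma trace_eq_of_intertwine:
  fixes g :: "complex^2^2"
  assumes g: "g \<in> SU2" and e: "g ** h = k ** g"
  shows "trace h = trace k"
proof -
  have "k = k ** (g ** adjoint_mat g)"
    by (simp add: adjoint_inverse(1)[OF g])
  also have "\<dots> = g ** h ** adjoint_mat g"
    by (simp add: e matrix_mul_assoc)
  finally have "trace k = trace (adjoint_mat g ** (g ** h))"
    by (metis trace_mul_sym)
  then show ?thesis
    by (simp add: matrix_mul_assoc adjoint_inverse(2)[OF g])
qed

text \<open>The two real parts differ by \<open>2 * sin \<phi> * Im z\<close>.\<close>

lemma Im_eq_0_of_Re_rotate:
  assumes "Re (cis \<phi> * z) = Re (cnj (cis \<phi>) * z)" and "sin \<phi> \<noteq> 0"
  shows "Im z = 0"
  using assms by simp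

lemma real_multiple_of_cis:
  assumes "Im (cnj (cis \<phi>) * z) = 0"
  obtains r where "z = cis \<phi> * of_real r"
proof
  have "cnj (cis \<phi>) * z = of_real (Re (cnj (cis \<phi>) * z))"
    using assms by (simp add: complex_eq_iff)
  then have "cis \<phi> * (cnj (cis \<phi>) * z) = cis \<phi> * of_real (Re (cnj (cis \<phi>) * z))"
    by simp
  then show "z = cis \<phi> * of_real (Re (cnj (cis \<phi>) * z))"
    by (simp add: cis_cnj cis_mult mult.assoc [symmetric])
qed

lemma quat_eq_iff: "quat z w = quat z' w' \<longleftrightarrow> z = z' \<and> w = w'"
  by (auto simp: mat2_eq_iff)

text \<open>The j-components of the two products agree identically. The complex components are
  \<open>e * P\<close> and \<open>e * cnj P\<close>, so all that remains is that \<open>P\<close> is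
  real.\<close>

lemma intertwine_iff:
  "quat (cis \<phi> * of_real r) (cis \<phi> * u) ** quat (cnj (cis \<phi>) * of_real s) w =
     quat (cis (2 * \<phi>)) 0 ** (quat (cnj (cis \<phi>) * of_real s) w ** quat (cis \<phi> * of_real r) (cis \<phi> * u))
   \<longleftrightarrow> sin \<phi> * r * s + Im (u * cnj w) = 0" (is "?L \<longleftrightarrow> ?R")
proof -
  define e where "e = cis \<phi>"
  have e1: "e * cnj e = 1"
    by (simp add: e_def cis_cnj cis_mult)
  have e2: "cis (2 * \<phi>) = e * e"
    by (simp add: e_def cis_mult)
  define P where "P = cnj e * of_real (r * s) - u * cnj w"
  have "?L \<longleftrightarrow> e * cnj e * of_real (r * s) - e * u * cnj w
                = e * (e * (e * cnj e * of_real (r * s) - cnj e * cnj u * w))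
      \<and> e * of_real r * w + e * u * (e * of_real s) = e * e * (cnj e * of_real s * (e * u) + w * (cnj e * of_real r))"
    unfolding e_def [symmetric] e2 by (simp add: quat_mult quat_eq_iff algebra_simps)
  also have "e * of_real r * w + e * u * (e * of_real s) = e * e * (cnj e * of_real s * (e * u) + w * (cnj e * of_real r))"
    using e1 by algebra
  also have "e * cnj e * of_real (r * s) - e * u * cnj w = e * P"
    by (simp add: P_def algebra_simps)
  also have "e * (e * (e * cnj e * of_real (r * s) - cnj e * cnj u * w)) = e * (cnj P)"
    using e1 unfolding P_def complex_cnj_diff complex_cnj_mult complex_cnj_cnj complex_cnj_complex_of_real
    by algebra
  also have "e * P = e * cnj P \<longleftrightarrow> P = cnj P"
    using e1 by auto
  also have "P = cnj P \<longleftrightarrow> Im P = 0"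
    by (auto simp: complex_eq_iff)
  also have "Im P = - (sin \<phi> * r * s + Im (u * cnj w))"
    by (simp add: P_def e_def)
  finally show ?thesis by (simp only: neg_equal_0_iff_equal simp_thms)
qed

lemma X_set_iff:
  assumes "0 < \<theta>" "\<theta> < 2 * pi"
  shows "(g, h) \<in> X_set \<theta> \<longleftrightarrow>
    (\<exists>r u s w. g = quat (cis (\<theta>/2) * of_real r) (cis (\<theta>/2) * u) \<and> h = quat (cnj (cis (\<theta>/2)) * of_real s) w \<and>
       r\<^sup>2 + (cmod u)\<^sup>2 = 1 \<and> s\<^sup>2 + (cmod w)\<^sup>2 = 1 \<and> sin (\<theta>/2) * r * s + Im (u * cnj w) = 0)"
    (is "_ \<longleftrightarrow> ?R")
proof
  assume "(g, h) \<in> X_set \<theta>"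
  then have g: "g \<in> SU2" and h: "h \<in> SU2" and "commutator g h = quat (cis \<theta>) 0"
    by (auto simp: X_set_def)
  then have e: "g ** h = quat (cis \<theta>) 0 ** (h ** g)"
    by (simp add: commutator_eq_iff)
  have S: "sin (\<theta>/2) \<noteq> 0"
    using assms by (simp add: sin_gt_zero less_imp_neq[symmetric])
  define \<phi> where "\<phi> = \<theta> / 2"
  have cis2: "cis \<theta> = cis \<phi> * cis \<phi>"
    by (simp add: \<phi>_def cis_mult)
  have cc: "cis \<phi> * cnj (cis \<phi>) = 1"
    by (simp add: cis_cnj cis_mult)
  obtain z v where gz: "g = quat z v" "(cmod z)\<^sup>2 + (cmod v)\<^sup>2 = 1"
    using g by (auto simp: SU2_eq_unit_quaternions)
  obtain z' w where hz: "h = quat z' w" "(cmod z')\<^sup>2 + (cmod w)\<^sup>2 = 1"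
    using h by (auto simp: SU2_eq_unit_quaternions)
  \<comment> \<open>\<open>g ** h = (D ** h) ** g\<close> with
    \<open>D = quat (cis \<theta>) 0\<close>, so \<open>h\<close> and \<open>D ** h\<close> are
    conjugate.\<close>
  have "trace h = trace (quat (cis \<theta>) 0 ** h)"
    using e by (intro trace_eq_of_intertwine[OF g]) (simp add: matrix_mul_assoc)
  then have "Re z' = Re (cis \<theta> * z')"
    by (simp add: hz quat_mult trace_quat del: of_real_mult times_complex.sel)
  \<comment> \<open>Splitting \<open>cis \<theta>\<close> into two half rotations makes the trace
    identity symmetric about \<open>cis \<phi> * z'\<close>.\<close>
  moreover have "z' = cnj (cis \<phi>) * (cis \<phi> * z')" "cis \<theta> * z' = cis \<phi> * (cis \<phi> * z')"
    using cc unfolding cis2 by (algebra, simp only: mult.assoc)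
  ultimately have "Re (cis \<phi> * (cis \<phi> * z')) = Re (cnj (cis \<phi>) * (cis \<phi> * z'))"
    by metis
  then have "Im (cis \<phi> * z') = 0"
    using S by (intro Im_eq_0_of_Re_rotate) (auto simp: \<phi>_def)
  then have "Im (cnj (cis (- \<phi>)) * z') = 0"
    by (simp add: cis_cnj)
  then obtain s where s: "z' = cis (- \<phi>) * of_real s"
    by (rule real_multiple_of_cis)
  \<comment> \<open>Multiplying by the inverse of \<open>D\<close> exchanges the roles:
    \<open>g\<close> is conjugate to its product with that inverse.\<close>
  have "quat (cnj (cis \<theta>)) 0 ** (g ** h) = (quat (cnj (cis \<theta>)) 0 ** quat (cis \<theta>) 0) ** (h ** g)"
    by (simp add: e matrix_mul_assoc)
  also have "quat (cnj (cis \<theta>)) 0 ** quat (cis \<theta>) 0 = mat 1"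
    by (simp add: quat_mult cis_cnj cis_mult quat_one)
  finally have "trace g = trace (quat (cnj (cis \<theta>)) 0 ** g)"
    by (intro trace_eq_of_intertwine[OF h]) (simp add: matrix_mul_assoc)
  then have "Re z = Re (cnj (cis \<theta>) * z)"
    by (simp add: gz quat_mult trace_quat del: of_real_mult times_complex.sel)
  moreover have "z = cis \<phi> * (cnj (cis \<phi>) * z)" "cnj (cis \<theta>) * z = cnj (cis \<phi>) * (cnj (cis \<phi>) * z)"
    using cc unfolding cis2 complex_cnj_mult by (algebra, simp only: mult.assoc)
  ultimately have "Re (cis \<phi> * (cnj (cis \<phi>) * z)) = Re (cnj (cis \<phi>) * (cnj (cis \<phi>) * z))"
    by metis
  then have "Im (cnj (cis \<phi>) * z) = 0"
    using S by (intro Im_eq_0_of_Re_rotate) (auto simp: \<phi>_def)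
  then obtain r where r: "z = cis \<phi> * of_real r"
    by (rule real_multiple_of_cis)
  \<comment> \<open>Taking \<open>cis \<phi>\<close> out of the j-part as well makes it a common
    left factor of \<open>g\<close>, the shape that \<open>intertwine_iff\<close> expects.\<close>
  define u where "u = cnj (cis \<phi>) * v"
  have v: "v = cis \<phi> * u"
    using cc by (simp add: u_def mult.assoc [symmetric])
  have gh: "g = quat (cis \<phi> * of_real r) (cis \<phi> * u)" "h = quat (cnj (cis \<phi>) * of_real s) w"
    by (simp_all add: gz hz r s v cis_cnj)
  have "cis \<theta> = cis (2 * \<phi>)"
    by (simp add: \<phi>_def)
  then have "sin \<phi> * r * s + Im (u * cnj w) = 0"
    using e unfolding gh by (simp only: intertwine_iff)
  moreover have "r\<^sup>2 + (cmod u)\<^sup>2 = 1" "s\<^sup>2 + (cmod w)\<^sup>2 = 1"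
    using gz(2) hz(2) by (simp_all add: r s v norm_mult)
  ultimately show ?R
    using gh unfolding \<phi>_def by blast
next
  assume ?R
  then obtain r u s w where
    gh: "g = quat (cis (\<theta>/2) * of_real r) (cis (\<theta>/2) * u)" "h = quat (cnj (cis (\<theta>/2)) * of_real s) w"
    and n: "r\<^sup>2 + (cmod u)\<^sup>2 = 1" "s\<^sup>2 + (cmod w)\<^sup>2 = 1"
    and o: "sin (\<theta>/2) * r * s + Im (u * cnj w) = 0"
    by blast
  have S: "g \<in> SU2" "h \<in> SU2"
    using n by (simp_all add: gh quat_mem_SU2 norm_mult)
  have "g ** h = quat (cis \<theta>) 0 ** (h ** g)"
    using o intertwine_iff[of "\<theta>/2" r u s w] by (simp add: gh)
  then show "(g, h) \<in> X_set \<theta>"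
    using S by (simp add: X_set_def commutator_eq_iff)
qed

section \<open>Lifting orthonormal pairs to unit quaternions\<close>

text \<open>The numbers \<open>\<sigma> = a + b\<close> and \<open>\<tau> = a - b\<close> satisfy \<open>\<sigma>\<^sup>2 = w + 2 m\<close>, \<open>\<tau>\<^sup>2 = w - 2 m\<close>,
  \<open>\<sigma> * cnj \<tau> = p - i s\<close>.  The hypotheses make these compatible, and they determine \<open>(\<sigma>, \<tau>)\<close> up to
  a common sign.\<close>

lemma orthonormal_pair_lift:
  fixes p s :: real and m w :: complex
  assumes p: "p\<^sup>2 + 4 * (cmod m)\<^sup>2 = 1" and s: "s\<^sup>2 + (cmod w)\<^sup>2 = 1"
    and o: "p * s + 2 * Im (m * cnj w) = 0"
  obtains a b where "(cmod a)\<^sup>2 + (cmod b)\<^sup>2 = 1" "(cmod a)\<^sup>2 - (cmod b)\<^sup>2 = p"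
    "a * b = m" "2 * Im (a * cnj b) = s" "a\<^sup>2 + b\<^sup>2 = w"
proof -
  define \<sigma> where "\<sigma> = csqrt (w + 2 * m)"
  have \<sigma>: "\<sigma>\<^sup>2 = w + 2 * m"
    by (simp add: \<sigma>_def)
  define \<kappa> where "\<kappa> = Complex p (- s)"
  \<comment> \<open>The hypotheses give \<open>\<sigma> * cnj \<tau>\<close> and
    \<open>\<kappa>\<close> the same square. Flipping the sign of \<open>\<tau>\<close> keeps
    \<open>\<tau>\<^sup>2\<close> and repairs a wrong sign of the product.\<close>
  have "\<exists>\<tau>. \<tau>\<^sup>2 = w - 2 * m \<and> \<sigma> * cnj \<tau> = \<kappa>"
  proof -
    define \<tau> where "\<tau> = csqrt (w - 2 * m)"
    have \<tau>: "\<tau>\<^sup>2 = w - 2 * m"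
      by (simp add: \<tau>_def)
    have "(\<sigma> * cnj \<tau>)\<^sup>2 = (w + 2 * m) * cnj (w - 2 * m)"
      by (simp add: power_mult_distrib \<sigma> \<tau> complex_cnj_power [symmetric] del: complex_cnj_power)
    also have "\<dots> = \<kappa>\<^sup>2"
      using p s o unfolding cmod_power2
      by (simp add: \<kappa>_def complex_eq_iff power2_eq_square algebra_simps)
    finally have "\<sigma> * cnj \<tau> = \<kappa> \<or> \<sigma> * cnj (- \<tau>) = \<kappa>"
      by (auto simp: power2_eq_iff)
    moreover have "(- \<tau>)\<^sup>2 = w - 2 * m"
      using \<tau> by simp
    ultimately show ?thesis
      using \<tau> by blast
  qed
  then obtain \<tau> where \<tau>: "\<tau>\<^sup>2 = w - 2 * m" and \<sigma>\<tau>: "\<sigma> * cnj \<tau> = \<kappa>"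
    by blast
  define a where "a = (\<sigma> + \<tau>) / 2"
  define b where "b = (\<sigma> - \<tau>) / 2"
  have st: "\<sigma> = a + b" "\<tau> = a - b"
    by (simp_all add: a_def b_def field_simps)
  have m: "a * b = m" and w: "a\<^sup>2 + b\<^sup>2 = w"
    using \<sigma> \<tau> unfolding st by algebra+
  have k: "(cmod a)\<^sup>2 - (cmod b)\<^sup>2 = p" "2 * Im (a * cnj b) = s"
    using \<sigma>\<tau> unfolding st \<kappa>_def cmod_power2
    by (simp_all add: complex_eq_iff power2_eq_square algebra_simps)
  have "((cmod a)\<^sup>2 + (cmod b)\<^sup>2)\<^sup>2 = p\<^sup>2 + 4 * (cmod m)\<^sup>2"
    unfolding k(1) [symmetric] m [symmetric] norm_mult by (simp add: power2_eq_square algebra_simps)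
  then have "((cmod a)\<^sup>2 + (cmod b)\<^sup>2)\<^sup>2 = 1"
    using p by simp
  then have "(cmod a)\<^sup>2 + (cmod b)\<^sup>2 = 1"
    unfolding power2_eq_1_iff by (smt (verit) zero_le_power2)
  then show thesis
    using k m w that by blast
qed

text \<open>Squares determine \<open>a + b\<close> and \<open>a - b\<close> up to separate signs,
  and the product \<open>(a + b) * cnj (a - b)\<close> ties the two signs together. This is the
  two-element fibre of the double cover of the rotation group.\<close>

lemma pair_eq_up_to_sign:
  fixes a b a' b' :: complex
  assumes m: "a * b = a' * b'" and w: "a\<^sup>2 + b\<^sup>2 = a'\<^sup>2 + b'\<^sup>2"
    and p: "(cmod a)\<^sup>2 - (cmod b)\<^sup>2 = (cmod a')\<^sup>2 - (cmod b')\<^sup>2"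
    and s: "Im (a * cnj b) = Im (a' * cnj b')"
  shows "a = a' \<and> b = b' \<or> a = - a' \<and> b = - b'"
proof -
  have 1: "(a + b)\<^sup>2 = (a' + b')\<^sup>2" and 2: "(a - b)\<^sup>2 = (a' - b')\<^sup>2"
    using m w by algebra+
  have 3: "(a + b) * cnj (a - b) = (a' + b') * cnj (a' - b')"
    using p s unfolding cmod_power2 by (simp add: complex_eq_iff power2_eq_square algebra_simps)
  have "a + b = a' + b' \<and> a - b = a' - b' \<or> a + b = - (a' + b') \<and> a - b = - (a' - b')"
  proof (cases "a + b = 0")
    \<comment> \<open>Here the product vanishes and ties nothing, but the sign of
      \<open>a + b = 0\<close> is immaterial, so that of \<open>a - b\<close> can be chosen
      alone.\<close>
    case True
    then have "a' + b' = 0"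
      using 1 by simp
    then show ?thesis
      using True 2 unfolding power2_eq_iff by (metis minus_zero)
  next
    case False
    from 1 consider "a + b = a' + b'" | "a + b = - (a' + b')"
      unfolding power2_eq_iff by blast
    then show ?thesis
    proof cases
      case 1
      then have "cnj (a - b) = cnj (a' - b')"
        using 3 False by (metis mult_cancel_left)
      then show ?thesis
        using 1 by (simp only: complex_cnj_cancel_iff simp_thms)
    next
      case 2
      then have "(a + b) * cnj (a - b) = (a + b) * cnj (- (a' - b'))"
        using 3 by (simp only: complex_cnj_minus minus_mult_minus mult_minus_left mult_minus_right minus_minus)
      then have "cnj (a - b) = cnj (- (a' - b'))"
        using False by (metis mult_cancel_left)
      then show ?thesis
        using 2 by (simp only: complex_cnj_cancel_iff simp_thms)
    qed
  qed
  then show ?thesis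
  proof (elim disjE conjE)
    assume "a + b = a' + b'" "a - b = a' - b'"
    then have "2 * a = 2 * a'" "2 * b = 2 * b'"
      by algebra+
    then show ?thesis by simp
  next
    assume "a + b = - (a' + b')" "a - b = - (a' - b')"
    then have "2 * a = 2 * (- a')" "2 * b = 2 * (- b')"
      by algebra+
    then show ?thesis by (simp only: mult_cancel_left) simp
  qed
qed


section \<open>Continuity of \<open>quat\<close> and compactness of \<open>SU2\<close>\<close>

lemma continuous_on_quat [continuous_intros]:
  assumes "continuous_on T f" "continuous_on T g"
  shows "continuous_on T (\<lambda>x. quat (f x) (g x))"
proof -
  have "quat z w = (\<chi> i j. if i = 1 then if j = 1 then z else w else if j = 1 then - cnj w else cnj z)" for z w
    by (simp add: mat2_eq_iff)
  moreover have "continuous_on T (\<lambda>x. if i = 1 then if j = 1 then f x else g x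
      else if j = 1 then - cnj (g x) else cnj (f x))" for i j :: 2
    using assms by (cases "i = 1"; cases "j = 1") (auto intro!: continuous_intros)
  ultimately show ?thesis
    by (simp add: continuous_on_vec_lambda)
qed

lemma compact_SU2: "compact SU2"
proof -
  have "SU2 = vec_quat ` sphere 0 1"
  proof (intro set_eqI iffI)
    fix A assume A: "A \<in> SU2"
    then have "A = vec_quat (quat_vec A)" "norm (quat_vec A) = 1"
      using quat_vec_inverse vec_quat_mem_SU2 by metis+
    then show "A \<in> vec_quat ` sphere 0 1"
      by (metis image_eqI mem_sphere_0)
  qed (auto simp: vec_quat_mem_SU2)
  moreover have "continuous_on (sphere 0 1) vec_quat"
    using linear_vec_quat linear_continuous_on linear_conv_bounded_linear by blast
  ultimately show ?thesis
    by (metis compact_continuous_image compact_sphere)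
qed

section \<open>Parametrizing \<open>X_set\<close> by \<open>SU2\<close>\<close>

definition axis_coord :: "complex \<Rightarrow> complex \<Rightarrow> real" where
  "axis_coord a b = (cmod a)\<^sup>2 - (cmod b)\<^sup>2"

text \<open>The inverse form takes (p, q) to (p/S, q). Clearing the denominator gives (p, S q),
  whose length this is, as |q| = 2 |a b|.\<close>

definition axis_norm :: "real \<Rightarrow> complex \<Rightarrow> complex \<Rightarrow> real" where
  "axis_norm S a b = sqrt ((axis_coord a b)\<^sup>2 + (2 * S * cmod (a * b))\<^sup>2)"

text \<open>In coordinates \<open>p i + q j\<close> for pure quaternions, \<open>A = a + b j\<close> takes \<open>i\<close> to \<open>p = axis_coord a b\<close>,
  \<open>q = - 2 i a b\<close>, and \<open>j\<close> to \<open>p = 2 Im (a * cnj b)\<close>, \<open>q = a\<^sup>2 + b\<^sup>2\<close>.  The image of \<open>i\<close> is then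
  transformed by the inverse of the form \<open>diag (S, 1, 1)\<close> and normalised.\<close>

definition X_param :: "real \<Rightarrow> complex^2^2 \<Rightarrow> (complex^2^2) \<times> (complex^2^2)" where
  "X_param \<theta> A =
    (let a = A $ 1 $ 1; b = A $ 1 $ 2; S = sin (\<theta>/2); N = axis_norm S a b in
      (quat (cis (\<theta>/2) * of_real (axis_coord a b / N)) (cis (\<theta>/2) * (of_real (2 * S / N) * (a * b))),
       quat (cnj (cis (\<theta>/2)) * of_real (2 * Im (a * cnj b))) (a\<^sup>2 + b\<^sup>2)))"

lemma X_param_quat:
  "X_param \<theta> (quat a b) =
     (let S = sin (\<theta>/2); N = axis_norm S a b in
      (quat (cis (\<theta>/2) * of_real (axis_coord a b / N)) (cis (\<theta>/2) * (of_real (2 * S / N) * (a * b))),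
       quat (cnj (cis (\<theta>/2)) * of_real (2 * Im (a * cnj b))) (a\<^sup>2 + b\<^sup>2)))"
  by (simp add: X_param_def)

text \<open>Rotations take i and j to orthonormal vectors; this lemma,
  \<open>second_axis_unit\<close> and \<open>axes_orthogonal\<close> express that in
  coordinates.\<close>

lemma axis_unit:
  assumes "(cmod a)\<^sup>2 + (cmod b)\<^sup>2 = 1"
  shows "(axis_coord a b)\<^sup>2 + 4 * (cmod (a * b))\<^sup>2 = 1"
proof -
  have "(axis_coord a b)\<^sup>2 + 4 * (cmod (a * b))\<^sup>2 = ((cmod a)\<^sup>2 + (cmod b)\<^sup>2)\<^sup>2"
    by (simp add: axis_coord_def norm_mult power2_eq_square algebra_simps)
  then show ?thesis
    by (simp add: assms)
qed

lemma second_axis_unit: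
  assumes "(cmod a)\<^sup>2 + (cmod b)\<^sup>2 = 1"
  shows "(2 * Im (a * cnj b))\<^sup>2 + (cmod (a\<^sup>2 + b\<^sup>2))\<^sup>2 = 1"
proof -
  have "(2 * Im (a * cnj b))\<^sup>2 + (cmod (a\<^sup>2 + b\<^sup>2))\<^sup>2 = ((cmod a)\<^sup>2 + (cmod b)\<^sup>2)\<^sup>2"
    unfolding cmod_power2 by (simp add: power2_eq_square algebra_simps)
  then show ?thesis
    by (simp add: assms)
qed

lemma axes_orthogonal: "axis_coord a b * (2 * Im (a * cnj b)) + 2 * Im (a * b * cnj (a\<^sup>2 + b\<^sup>2)) = 0"
  unfolding axis_coord_def cmod_power2 by (simp add: power2_eq_square algebra_simps)

lemma axis_norm_pos:
  assumes "(cmod a)\<^sup>2 + (cmod b)\<^sup>2 = 1" and S: "S \<noteq> 0"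
  shows "axis_norm S a b > 0"
proof -
  have "axis_coord a b \<noteq> 0 \<or> cmod (a * b) \<noteq> 0"
    using axis_unit[OF assms(1)] by auto
  then have "(axis_coord a b)\<^sup>2 + (2 * S * cmod (a * b))\<^sup>2 > 0"
    using S by (auto simp: sum_power2_gt_zero_iff)
  then show ?thesis
    by (simp add: axis_norm_def)
qed

lemma axis_norm_power2: "(axis_norm S a b)\<^sup>2 = (axis_coord a b)\<^sup>2 + 4 * S\<^sup>2 * (cmod (a * b))\<^sup>2"
  by (simp add: axis_norm_def power_mult_distrib)

lemma X_param_mem:
  assumes \<theta>: "0 < \<theta>" "\<theta> < 2 * pi" and A: "A \<in> SU2"
  shows "X_param \<theta> A \<in> X_set \<theta>"
proof -
  obtain a b where A: "A = quat a b" and ab: "(cmod a)\<^sup>2 + (cmod b)\<^sup>2 = 1"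
    using A by (auto simp: SU2_eq_unit_quaternions)
  define S where "S = sin (\<theta>/2)"
  have S: "S > 0"
    using \<theta> by (simp add: S_def sin_gt_zero)
  define N where "N = axis_norm S a b"
  have N: "N > 0"
    using axis_norm_pos[OF ab] S by (simp add: N_def)
  have "(axis_coord a b / N)\<^sup>2 + (cmod (of_real (2 * S / N) * (a * b)))\<^sup>2
      = ((axis_coord a b)\<^sup>2 + 4 * S\<^sup>2 * (cmod (a * b))\<^sup>2) / N\<^sup>2"
    by (simp add: norm_mult norm_divide power_mult_distrib power_divide add_divide_distrib)
  then have 1: "(axis_coord a b / N)\<^sup>2 + (cmod (of_real (2 * S / N) * (a * b)))\<^sup>2 = 1"
    using N by (simp add: N_def flip: axis_norm_power2)
  \<comment> \<open>The form \<open>diag (S, 1, 1)\<close> undoes the inverse form, leaving a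
    multiple of the ordinary inner product of the images of i and j.\<close>
  have "S * (axis_coord a b / N) * (2 * Im (a * cnj b)) + Im (of_real (2 * S / N) * (a * b) * cnj (a\<^sup>2 + b\<^sup>2))
      = S / N * (axis_coord a b * (2 * Im (a * cnj b)) + 2 * Im (a * b * cnj (a\<^sup>2 + b\<^sup>2)))"
    unfolding mult.assoc scaleR_conv_of_real [symmetric] scaleR_complex.sel by (simp add: algebra_simps)
  then have "S * (axis_coord a b / N) * (2 * Im (a * cnj b)) + Im (of_real (2 * S / N) * (a * b) * cnj (a\<^sup>2 + b\<^sup>2)) = 0"
    unfolding axes_orthogonal by simp
  with 1 show ?thesis
    unfolding A X_param_quat Let_def X_set_iff[OF \<theta>] S_def [symmetric] N_def [symmetric]
    using second_axis_unit[OF ab] by blast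
qed

text \<open>The construction is run backwards: the form is applied to the first vector, the result
  is normalised, and the orthonormal pair is lifted by \<open>orthonormal_pair_lift\<close>.\<close>

lemma X_param_surj:
  assumes \<theta>: "0 < \<theta>" "\<theta> < 2 * pi" and x: "x \<in> X_set \<theta>"
  obtains A where "A \<in> SU2" "x = X_param \<theta> A"
proof -
  obtain g h where gh: "x = (g, h)"
    by fastforce
  define S where "S = sin (\<theta>/2)"
  have S: "S > 0"
    using \<theta> by (simp add: S_def sin_gt_zero)
  obtain r u s w where
    g: "g = quat (cis (\<theta>/2) * of_real r) (cis (\<theta>/2) * u)" and h: "h = quat (cnj (cis (\<theta>/2)) * of_real s) w"
    and n: "r\<^sup>2 + (cmod u)\<^sup>2 = 1" and n': "s\<^sup>2 + (cmod w)\<^sup>2 = 1"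
    and o: "S * r * s + Im (u * cnj w) = 0"
    using x unfolding gh X_set_iff[OF \<theta>] S_def by blast
  \<comment> \<open>Up to the factor \<open>S\<close>, the form takes the first vector to one with
    coordinates \<open>r\<close> and \<open>- i u / S\<close>; \<open>L\<close> is the squared
    length of the latter.\<close>
  define L where "L = r\<^sup>2 + (cmod u)\<^sup>2 / S\<^sup>2"
  have "r \<noteq> 0 \<or> cmod u \<noteq> 0"
    using n by auto
  then have L: "L > 0"
    unfolding L_def using S by (auto intro: add_pos_nonneg add_nonneg_pos)
  define K where "K = 1 / sqrt L"
  have K: "K > 0" "K\<^sup>2 * L = 1"
    using L by (simp_all add: K_def power_divide)
  define m where "m = of_real (K / (2 * S)) * u"
  have cm: "cmod m = K / (2 * S) * cmod u"
    using K S by (simp add: m_def norm_mult norm_divide)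
  have "(K * r)\<^sup>2 + 4 * (cmod m)\<^sup>2 = K\<^sup>2 * L"
    by (simp add: cm L_def power_mult_distrib power_divide algebra_simps)
  then have 1: "(K * r)\<^sup>2 + 4 * (cmod m)\<^sup>2 = 1"
    using K by simp
  have "2 * Im (m * cnj w) = K / S * Im (u * cnj w)"
    unfolding m_def mult.assoc scaleR_conv_of_real [symmetric] scaleR_complex.sel by simp
  also have "Im (u * cnj w) = - (S * r * s)"
    using o by simp
  finally have 2: "K * r * s + 2 * Im (m * cnj w) = 0"
    using S by simp
  obtain a b where ab: "(cmod a)\<^sup>2 + (cmod b)\<^sup>2 = 1" "axis_coord a b = K * r"
    "a * b = m" "2 * Im (a * cnj b) = s" "a\<^sup>2 + b\<^sup>2 = w"
    unfolding axis_coord_def using orthonormal_pair_lift[OF 1 n' 2] by blast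
  \<comment> \<open>Since \<open>(r, - i u)\<close> is a unit vector, the denominator in
    \<open>X_param\<close> is exactly the \<open>K\<close> introduced here, and the two
    normalisations cancel.\<close>
  have "(axis_norm S a b)\<^sup>2 = K\<^sup>2 * (r\<^sup>2 + (cmod u)\<^sup>2)"
    using S by (simp add: axis_norm_power2 ab cm power_mult_distrib power_divide algebra_simps)
  then have "(axis_norm S a b)\<^sup>2 = K\<^sup>2"
    by (simp add: n)
  then have N: "axis_norm S a b = K"
    using K by (simp add: axis_norm_def)
  have "x = X_param \<theta> (quat a b)"
    unfolding X_param_quat Let_def S_def [symmetric] N gh g h ab(2-)
    using S K by (simp add: m_def)
  then show thesis
    using that ab(1) quat_mem_SU2 by blast
qed

lemma X_param_eq_iff:
  assumes \<theta>: "0 < \<theta>" "\<theta> < 2 * pi" and A: "A \<in> SU2" and B: "B \<in> SU2"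
  shows "X_param \<theta> A = X_param \<theta> B \<longleftrightarrow> psu_class A = psu_class B"
proof
  obtain a b where A: "A = quat a b" and ab: "(cmod a)\<^sup>2 + (cmod b)\<^sup>2 = 1"
    using A by (auto simp: SU2_eq_unit_quaternions)
  obtain c d where B: "B = quat c d" and cd: "(cmod c)\<^sup>2 + (cmod d)\<^sup>2 = 1"
    using B by (auto simp: SU2_eq_unit_quaternions)
  define S where "S = sin (\<theta>/2)"
  have S: "S > 0"
    using \<theta> by (simp add: S_def sin_gt_zero)
  define N where "N = axis_norm S a b"
  define M where "M = axis_norm S c d"
  have NM: "N > 0" "M > 0"
    using axis_norm_pos[OF ab] axis_norm_pos[OF cd] S by (simp_all add: N_def M_def)
  assume "X_param \<theta> A = X_param \<theta> B"
  then have p: "axis_coord a b / N = axis_coord c d / M"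
    and m: "of_real (2 * S / N) * (a * b) = of_real (2 * S / M) * (c * d)"
    and s: "2 * Im (a * cnj b) = 2 * Im (c * cnj d)" and w: "a\<^sup>2 + b\<^sup>2 = c\<^sup>2 + d\<^sup>2"
    unfolding A B X_param_quat Let_def S_def [symmetric] N_def [symmetric] M_def [symmetric]
    by (simp_all only: prod.inject quat_eq_iff mult_cancel_left of_real_eq_iff complex_cnj_zero_iff cis_neq_zero
        simp_thms)
  \<comment> \<open>Before normalisation the two first vectors are proportional with positive ratio
    \<open>k\<close>. Both images of i are unit vectors, which forces \<open>k = 1\<close>.\<close>
  define k where "k = N / M"
  have k: "k > 0"
    using NM by (simp add: k_def)
  have p': "axis_coord a b = k * axis_coord c d"
    using p NM by (simp add: k_def field_simps)
  have "a * b = of_real (N / (2 * S)) * (of_real (2 * S / N) * (a * b))"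
    using NM S by simp
  also have "\<dots> = of_real k * (c * d)"
    unfolding m using NM S by (simp add: k_def)
  finally have m': "a * b = of_real k * (c * d)" .
  have "1 = k\<^sup>2 * ((axis_coord c d)\<^sup>2 + 4 * (cmod (c * d))\<^sup>2)"
    using axis_unit[OF ab] unfolding p' m' by (simp add: norm_mult power_mult_distrib algebra_simps)
  then have "k\<^sup>2 = 1"
    by (simp only: axis_unit[OF cd])
  then have "k = 1"
    using k by (simp add: power2_eq_1_iff)
  then have "a = c \<and> b = d \<or> a = - c \<and> b = - d"
    using p' m' s w by (intro pair_eq_up_to_sign) (simp_all add: axis_coord_def)
  then show "psu_class A = psu_class B"
    by (auto simp: psu_class_eq_iff A B mat2_eq_iff)
next
  assume "psu_class A = psu_class B"
  then consider "A = B" | "A = - B"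
    unfolding psu_class_eq_iff by blast
  \<comment> \<open>\<open>X_param\<close> is even in the matrix entries.\<close>
  then show "X_param \<theta> A = X_param \<theta> B"
    by cases (simp_all add: X_param_def Let_def axis_norm_def axis_coord_def)
qed

text \<open>Left multiplication by \<open>e\<close> in the torus multiplies \<open>a\<close> and
  \<open>b\<close> by \<open>e\<close>. The real coordinates and the norm are unchanged, while
  \<open>a * b\<close> and \<open>a\<^sup>2 + b\<^sup>2\<close> acquire \<open>e * e\<close>, just
  as conjugation by \<open>e\<close> acts on j-parts.\<close>

lemma X_param_torus:
  assumes t: "t \<in> torus" and A: "A \<in> SU2"
  shows "X_param \<theta> (t ** A) = diag_conj t (X_param \<theta> A)"
proof -
  obtain \<alpha> where t: "t = quat (cis \<alpha>) 0"
    using t by (auto simp: torus_eq)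
  obtain a b where A: "A = quat a b"
    using A by (auto simp: SU2_eq_unit_quaternions)
  define e where "e = cis \<alpha>"
  have e: "cmod e = 1" "e * cnj e = 1"
    by (simp_all add: e_def cis_cnj cis_mult)
  have tS: "quat e 0 \<in> SU2"
    by (simp add: quat_mem_SU2 e)
  have conj: "conj_by (quat e 0) (quat z w) = quat z (e * e * w)" for z w
    using e(2) by (simp add: conj_by_def matrix_inv_SU2[OF tS] adjoint_quat quat_mult mat2_eq_iff algebra_simps)
  have 1: "axis_coord (e * a) (e * b) = axis_coord a b"
    by (simp add: axis_coord_def norm_mult e)
  have 2: "axis_norm S (e * a) (e * b) = axis_norm S a b" for S
    by (simp add: axis_norm_def 1 norm_mult e)
  have "e * a * cnj (e * b) = (e * cnj e) * (a * cnj b)"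
    by simp
  then have 3: "e * a * cnj (e * b) = a * cnj b"
    by (simp only: e mult_1)
  have 4: "(e * a)\<^sup>2 + (e * b)\<^sup>2 = e * e * (a\<^sup>2 + b\<^sup>2)"
    by (simp add: power2_eq_square algebra_simps)
  have 5: "x * (y * (e * a * (e * b))) = e * e * (x * (y * (a * b)))" for x y
    by (simp add: mult_ac)
  have "t ** A = quat (e * a) (e * b)"
    by (simp add: t A quat_mult e_def)
  then show ?thesis
    unfolding A t e_def [symmetric]
    by (simp only: X_param_quat Let_def 1 2 3 4 5 diag_conj_def fst_conv snd_conv conj)
qed

section \<open>Passing to the quotient\<close>

lemma continuous_on_X_param:
  assumes \<theta>: "0 < \<theta>" "\<theta> < 2 * pi"
  shows "continuous_on SU2 (X_param \<theta>)"
proof -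
  have S: "sin (\<theta>/2) \<noteq> 0"
    using \<theta> by (simp add: sin_gt_zero less_imp_neq[symmetric])
  have nz: "axis_norm (sin (\<theta>/2)) (A $ 1 $ 1) (A $ 1 $ 2) \<noteq> 0" if "A \<in> SU2" for A
  proof -
    obtain a b where "A = quat a b" "(cmod a)\<^sup>2 + (cmod b)\<^sup>2 = 1"
      using \<open>A \<in> SU2\<close> by (auto simp: SU2_eq_unit_quaternions)
    then show ?thesis
      using axis_norm_pos[OF _ S, of a b] by simp
  qed
  have p: "continuous_on SU2 (\<lambda>A. axis_coord (A $ 1 $ 1) (A $ 1 $ 2))"
    unfolding axis_coord_def by (intro continuous_intros)
  then have N: "continuous_on SU2 (\<lambda>A. axis_norm (sin (\<theta>/2)) (A $ 1 $ 1) (A $ 1 $ 2))"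
    unfolding axis_norm_def by (intro continuous_intros)
  show ?thesis
    unfolding X_param_def Let_def using p N nz by (intro continuous_intros) auto
qed

text \<open>A continuous surjection from a compact space onto a Hausdorff space is a quotient map.
  This avoids proving continuity of the lift, which involves square roots with a choice of
  sign.\<close>

lemma quotient_map_X_param:
  assumes \<theta>: "0 < \<theta>" "\<theta> < 2 * pi"
  shows "quotient_map (top_of_set SU2) (top_of_set (X_set \<theta>)) (X_param \<theta>)"
proof (rule continuous_imp_quotient_map)
  show "continuous_map (top_of_set SU2) (top_of_set (X_set \<theta>)) (X_param \<theta>)"
    using continuous_on_X_param[OF \<theta>] X_param_mem[OF \<theta>] by auto
  show "X_param \<theta> ` topspace (top_of_set SU2) = topspace (top_of_set (X_set \<theta>))"
    using X_param_mem[OF \<theta>] by (auto elim: X_param_surj[OF \<theta>])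
qed (simp_all add: compact_space_subtopology compact_SU2 Hausdorff_space_subtopology)

theorem theorem3p1:
  fixes \<theta> :: real
  assumes "0 < \<theta>" and "\<theta> \<le> pi"
  shows "\<exists>\<Phi>. homeomorphic_map (top_of_set (X_set \<theta>)) PSU2 \<Phi> \<and>
              (\<forall>t\<in>torus. \<forall>p\<in>X_set \<theta>. \<Phi> (diag_conj t p) = left_mult t (\<Phi> p))"
proof -
  have \<theta>: "0 < \<theta>" "\<theta> < 2 * pi"
    using assms by auto
  \<comment> \<open>\<open>X_param \<theta>\<close> and \<open>psu_class\<close> are quotient maps
    on \<open>SU2\<close> with the same fibres, so each factors through the other. The formula for
    \<open>\<Phi>\<close> on the parametrization is kept because it reduces equivariance to
    \<open>X_param_torus\<close>.\<close>
  obtain \<Phi> where hom: "homeomorphic_map (top_of_set (X_set \<theta>)) PSU2 \<Phi>"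
    and \<Phi>: "\<And>A. A \<in> SU2 \<Longrightarrow> \<Phi> (X_param \<theta> A) = psu_class A"
  proof -
    note q = quotient_map_X_param[OF \<theta>] and r = quot_map_PSU2
    obtain k where k: "continuous_map (top_of_set (X_set \<theta>)) PSU2 k"
      "\<And>A. A \<in> SU2 \<Longrightarrow> k (X_param \<theta> A) = psu_class A"
      using quotient_map_lift_exists[OF q quotient_imp_continuous_map[OF r]] X_param_eq_iff[OF \<theta>]
      by (metis topspace_euclidean_subtopology)
    obtain l where l: "continuous_map PSU2 (top_of_set (X_set \<theta>)) l"
      "\<And>A. A \<in> SU2 \<Longrightarrow> l (psu_class A) = X_param \<theta> A"
      using quotient_map_lift_exists[OF r quotient_imp_continuous_map[OF q]] X_param_eq_iff[OF \<theta>]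
      by (metis topspace_euclidean_subtopology)
    have "topspace PSU2 = psu_class ` SU2" "X_set \<theta> = X_param \<theta> ` SU2"
      using q r by (auto simp: quotient_map_def)
    then have "homeomorphic_maps (top_of_set (X_set \<theta>)) PSU2 k l"
      using k l by (auto simp: homeomorphic_maps_def)
    then show thesis
      using that k(2) homeomorphic_maps_map by blast
  qed
  moreover have "\<Phi> (diag_conj t p) = left_mult t (\<Phi> p)" if t: "t \<in> torus" and p: "p \<in> X_set \<theta>" for t p
  proof -
    obtain A where A: "A \<in> SU2" "p = X_param \<theta> A"
      using p by (rule X_param_surj[OF \<theta>])
    moreover have "t ** A \<in> SU2"
      using t A(1) torus_subset_SU2 SU2_mult by blast
    ultimately show ?thesis
      using X_param_torus[OF t A(1), of \<theta>] by (metis \<Phi> left_mult_psu_class)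
  qed
  ultimately show ?thesis
    by blast
qed

end
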